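(* Let $m\ge 2$ be an integer. Then the set $\mathcal{X}_m$ is the same as the set $\widetilde{\mathcal{S}^*_m}$ of the inverses of permutations of Sós-type of degree $m$: $$\mathcal{X}_m=\widetilde{\mathcal{S}^*_m}.$$
   Context: $[m]=\{1,\dots,m\}$ and $\mathfrak{S}_m$ is the set of all bijections $[m]\to[m]$. For real $x$, $\{x\}=x-\lfloor x\rfloor$. $\mathrm{Mod}_m(j)\in\{0,1,\dots,m-1\}$ is the standard residue of the integer $j$ modulo $m$. $$\mathcal{X}_m=\{\theta\in\mathfrak{S}_m:\ \exists\,k\in[m-1]\ \forall\, i\in[m-1]\ \ \mathrm{Mod}_m(\theta(i+1)-\theta(i))\in\{k,k+1\}\}$$ (the permutations that are mod-$m$ congruential $m$-term quasi-progressions of diameter $1$). A permutation $\sigma\in\mathfrak{S}_m$ is a Sós permutation if there is a real $\alpha$ with $0<\{\sigma(1)\alpha\}<\{\sigma(2)\alpha\}<\cdots<\{\sigma(m)\alpha\}<1$. $\mathcal{S}_m$ is the set of Sós permutations of degree $m$, and $\mathcal{S}^*_m=\{\sigma^{-1}:\sigma\in\mathcal{S}_m\}$. A permutation $\sigma\in\mathfrak{S}_m$ is of Sós-type if there are reals $\alpha,\beta$ with $0<\{\sigma(1)\alpha+\beta\}<\{\sigma(2)\alpha+\beta\}<\cdots<\{\sigma(m)\alpha+\beta\}<1$; the set of inverses of permutations of Sós-type is identified with the shift-closure $\widetilde{\mathcal{S}^*_m}$ defined next. For $\theta,\theta'\in\mathfrak{S}_m$ write $\theta\sim\theta'$ (shift-equivalent)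 if there is $k\in[m]$ with $\theta'(i)\equiv\theta(i)+k\pmod m$ for all $i\in[m]$. For $T\subset\mathfrak{S}_m$, the shift-closure is $\widetilde{T}=\{\theta'\in\mathfrak{S}_m:\ \exists\,\theta\in T,\ \theta\sim\theta'\}$. *)

theory Defs
  imports Complex_Main "HOL-Combinatorics.Permutations" "HOL-Number_Theory.Cong"
begin

text \<open>
  Bijections of \<open>{1..m}\<close> are represented by functions \<open>p\<close> with \<open>p permutes {1..m}\<close>, i.e. extended
  by the identity outside \<open>{1..m}\<close>. Thus equality of functions is equality on \<open>{1..m}\<close>, and the
  group inverse is \<open>inv p\<close>.
\<close>

definition Sym :: "nat \<Rightarrow> (nat \<Rightarrow> nat) set" where
  "Sym m = {p. p permutes {1..m}}"

text \<open>The mod-\<open>m\<close> congruential \<open>m\<close>-term quasi-progressions of diameter 1. Differences are taken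
  in \<open>int\<close>, since subtraction on \<open>nat\<close> truncates.\<close>

definition X :: "nat \<Rightarrow> (nat \<Rightarrow> nat) set" where
  "X m = {\<theta> \<in> Sym m. \<exists>k\<in>{1..m - 1}. \<forall>i\<in>{1..m - 1}.
            (int (\<theta> (i + 1)) - int (\<theta> i)) mod int m \<in> {int k, int k + 1}}"

definition Sos :: "nat \<Rightarrow> (nat \<Rightarrow> nat) set" where
  "Sos m = {\<sigma> \<in> Sym m. \<exists>\<alpha>::real.
              0 < frac (real (\<sigma> 1) * \<alpha>) \<and>
              (\<forall>i\<in>{1..m - 1}. frac (real (\<sigma> i) * \<alpha>) < frac (real (\<sigma> (i + 1)) * \<alpha>)) \<and>
              frac (real (\<sigma> m) * \<alpha>) < 1}"

definition Sos_type :: "nat \<Rightarrow> (nat \<Rightarrow> nat) set" where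
  "Sos_type m = {\<sigma> \<in> Sym m. \<exists>\<alpha> \<beta> :: real.
              0 < frac (real (\<sigma> 1) * \<alpha> + \<beta>) \<and>
              (\<forall>i\<in>{1..m - 1}.
                 frac (real (\<sigma> i) * \<alpha> + \<beta>) < frac (real (\<sigma> (i + 1)) * \<alpha> + \<beta>)) \<and>
              frac (real (\<sigma> m) * \<alpha> + \<beta>) < 1}"

definition inverses :: "(nat \<Rightarrow> nat) set \<Rightarrow> (nat \<Rightarrow> nat) set" where
  "inverses T = {inv \<sigma> | \<sigma>. \<sigma> \<in> T}"

definition shift_equivalent :: "nat \<Rightarrow> (nat \<Rightarrow> nat) \<Rightarrow> (nat \<Rightarrow> nat) \<Rightarrow> bool" where
  "shift_equivalent m \<theta> \<theta>' \<longleftrightarrow> (\<exists>k\<in>{1..m}. \<forall>i\<in>{1..m}. [\<theta>' i = \<theta> i + k] (mod m))"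

definition shift_closure :: "nat \<Rightarrow> (nat \<Rightarrow> nat) set \<Rightarrow> (nat \<Rightarrow> nat) set" where
  "shift_closure m T = {\<theta>' \<in> Sym m. \<exists>\<theta>\<in>T. shift_equivalent m \<theta> \<theta>'}"

end

(*
  If theta i is the rank of frac (i * alpha + beta) among m such points, then m - theta i is a sum of
  values frac ((i - j) * alpha) up to a correction linear in the point, and this sum telescopes when
  i advances: modulo m, theta (i + 1) - theta i = m * alpha + frac ((i - m) * alpha) - frac (i * alpha),
  which takes only the two values floor (m * alpha) and floor (m * alpha) + 1.

  Conversely, injectivity of a quasi-progression with steps k and k + 1 forces the values followed by
  a step k + 1 to form a cyclic interval ending just before theta m. After a shift, the step
  at i is k + 1 exactly if theta i < theta m, and theta 1 = k + 1. With theta 0 = 0, theta a = 1 and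
  theta b = m, consecutive ranks then belong to indices differing by a, -b or a - b, that is, by a or
  2 * a modulo n = a + b. Hence a is a unit modulo n, and the slope U / n with a * U = 1 (mod n)
  realises the permutation. A general shift amounts to choosing beta inside a gap.
*)

theory Submission imports Defs begin

section \<open>Residues modulo \<open>m\<close> with representatives in
  \<open>{1..m}\<close>\<close>

lemma cong_residue_unique:
  assumes "[int u = int v] (mod int m)" "u \<in> {1..m}" "v \<in> {1..m}"
  shows "u = v"
proof -
  have "int m dvd int u - int v" using assms(1) by (simp add: cong_iff_dvd_diff)
  moreover have "\<bar>int u - int v\<bar> < int m" using assms(2,3) by auto
  ultimately show ?thesis using zdvd_not_zless[of "\<bar>int u - int v\<bar>" "int m"] by auto
qed

lemma residue_representative:
  assumes "m \<ge> 1"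
  obtains v where "v \<in> {1..m}" "[int v = r] (mod int m)"
proof -
  \<comment> \<open>Reducing \<open>r - 1\<close> and adding 1 back makes the class of 0 land on
    \<open>m\<close>.\<close>
  define v where "v = nat ((r - 1) mod int m) + 1"
  have b: "0 \<le> (r - 1) mod int m" "(r - 1) mod int m < int m" using assms by auto
  have "v \<in> {1..m}" using b unfolding v_def by (auto simp: nat_less_iff Suc_le_eq)
  moreover have "int v = (r - 1) mod int m + 1" using b by (simp add: v_def)
  then have "[int v = r] (mod int m)" by (simp add: cong_def mod_simps)
  ultimately show ?thesis using that by blast
qed

section \<open>Order of a point set on the circle\<close>

definition rank_order :: "nat \<Rightarrow> (nat \<Rightarrow> nat) \<Rightarrow> (nat \<Rightarrow> real) \<Rightarrow> bool" where
  "rank_order m \<theta> x \<longleftrightarrow>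
     (\<forall>i\<in>{1..m}. 0 < x i) \<and> (\<forall>i\<in>{1..m}. \<forall>j\<in>{1..m}. \<theta> i < \<theta> j \<longrightarrow> x i < x j)"

text \<open>Links \<open>rank_order\<close>, which compares all pairs of indices, to the chain of
  neighbours in \<open>Sos\<close> and \<open>Sos_type\<close>, taken at
  \<open>inv \<theta>\<close>.\<close>

lemma rank_order_iff_chain:
  assumes p: "\<theta> permutes {1..m}" and m: "m \<ge> 1"
  shows "rank_order m \<theta> x \<longleftrightarrow>
    0 < x (inv \<theta> 1) \<and> (\<forall>i\<in>{1..m - 1}. x (inv \<theta> i) < x (inv \<theta> (i + 1)))"
    (is "_ \<longleftrightarrow> ?R")
proof
  assume r: "rank_order m \<theta> x"
  have in': "inv \<theta> i \<in> {1..m}" if "i \<in> {1..m}" for i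
    using permutes_in_image[OF permutes_inv[OF p]] that by blast
  have "x (inv \<theta> i) < x (inv \<theta> (i + 1))" if "i \<in> {1..m - 1}" for i
  proof -
    have "inv \<theta> i \<in> {1..m}" "inv \<theta> (i + 1) \<in> {1..m}"
      using in'[of i] in'[of "i + 1"] that by auto
    moreover have "\<theta> (inv \<theta> i) < \<theta> (inv \<theta> (i + 1))"
      unfolding permutes_inverses(1)[OF p] by simp
    ultimately show ?thesis using r unfolding rank_order_def by blast
  qed
  moreover have "0 < x (inv \<theta> 1)" using r in'[of 1] m unfolding rank_order_def by auto
  ultimately show ?R by blast
next
  assume R: ?R
  have mono: "x (inv \<theta> r) < x (inv \<theta> s)" if "1 \<le> r" "r < s" "s \<le> m" for r s
    using that(2,3)
  proof (induction s)
    case (Suc s)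
    have "x (inv \<theta> s) < x (inv \<theta> (s + 1))" using R Suc.prems that(1) by auto
    then show ?case using Suc by (cases "r = s") auto
  qed simp
  have img: "\<theta> i \<in> {1..m}" if "i \<in> {1..m}" for i
    using permutes_in_image[OF p] that by blast
  have "x i < x j" if "i \<in> {1..m}" "j \<in> {1..m}" "\<theta> i < \<theta> j" for i j
    using mono[of "\<theta> i" "\<theta> j"] img[OF that(1)] img[OF that(2)] that(3)
    by (simp add: permutes_inverses(2)[OF p])
  moreover have "0 < x i" if "i \<in> {1..m}" for i
  proof -
    have "inv \<theta> (\<theta> i) = i" by (simp add: permutes_inverses(2)[OF p])
    then show ?thesis
      using mono[of 1 "\<theta> i"] img[OF that] R by (cases "\<theta> i = 1") auto
  qed
  ultimately show "rank_order m \<theta> x" unfolding rank_order_def by blast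
qed

lemma inv_mem_Sos_type_iff:
  assumes "\<theta> permutes {1..m}" "m \<ge> 1"
  shows "inv \<theta> \<in> Sos_type m \<longleftrightarrow> (\<exists>\<alpha> \<beta>. rank_order m \<theta> (\<lambda>i. frac (real i * \<alpha> + \<beta>)))"
  unfolding Sos_type_def Sym_def
  using permutes_inv[OF assms(1)] by (simp add: rank_order_iff_chain[OF assms] frac_lt_1)

lemma inv_mem_Sos_iff:
  assumes "\<theta> permutes {1..m}" "m \<ge> 1"
  shows "inv \<theta> \<in> Sos m \<longleftrightarrow> (\<exists>\<alpha>. rank_order m \<theta> (\<lambda>i. frac (real i * \<alpha>)))"
  unfolding Sos_def Sym_def
  using permutes_inv[OF assms(1)] by (simp add: rank_order_iff_chain[OF assms] frac_lt_1)

lemma mem_inverses_iff: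
  assumes "T \<subseteq> Sym m"
  shows "\<theta> \<in> inverses T \<longleftrightarrow> \<theta> permutes {1..m} \<and> inv \<theta> \<in> T"
proof
  assume "\<theta> \<in> inverses T"
  then obtain \<sigma> where s: "\<theta> = inv \<sigma>" "\<sigma> \<in> T" unfolding inverses_def by blast
  then have "\<sigma> permutes {1..m}" using assms unfolding Sym_def by blast
  then show "\<theta> permutes {1..m} \<and> inv \<theta> \<in> T"
    using s by (simp add: permutes_inv permutes_inv_inv)
next
  assume "\<theta> permutes {1..m} \<and> inv \<theta> \<in> T"
  then show "\<theta> \<in> inverses T"
    unfolding inverses_def by (auto simp: permutes_inv_inv intro!: exI[of _ "inv \<theta>"])
qed

lemma Sos_subset_Sym: "Sos m \<subseteq> Sym m"
  and Sos_type_subset_Sym: "Sos_type m \<subseteq> Sym m"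
  unfolding Sos_def Sos_type_def by auto

section \<open>Step sizes of inverses of permutations of Sos-type\<close>

text \<open>The right side differs from \<open>x - y\<close> by an integer and lies in [0, 1).
  Solved for the indicator, this turns a comparison of two points into fractional parts.\<close>

lemma frac_diff_eq:
  fixes x y :: real
  shows "frac (x - y) = frac x - frac y + of_bool (frac x < frac y)"
proof -
  have "x - y - (frac x - frac y + of_bool (frac x < frac y)) \<in> \<int>"
    unfolding frac_def by (cases "x - of_int \<lfloor>x\<rfloor> < y - of_int \<lfloor>y\<rfloor>") auto
  moreover have "0 \<le> frac x - frac y + of_bool (frac x < frac y)"
    "frac x - frac y + of_bool (frac x < frac y) < 1"
    using frac_lt_1[of x] frac_lt_1[of y] frac_ge_0[of x] frac_ge_0[of y]
    unfolding of_bool_def by (smt (verit))+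
  ultimately show ?thesis by (simp add: frac_unique_iff)
qed

lemma permutes_card_greater:
  assumes p: "\<theta> permutes {1..m}" and i: "i \<in> {1..m}"
  shows "card {j\<in>{1..m}. \<theta> i < \<theta> j} = m - \<theta> i"
proof -
  have "\<theta> ` {j\<in>{1..m}. \<theta> i < \<theta> j} = {\<theta> i<..m}"
  proof (intro set_eqI iffI)
    fix r assume "r \<in> {\<theta> i<..m}"
    then have "r \<in> {1..m}" "\<theta> i < r" by auto
    then show "r \<in> \<theta> ` {j\<in>{1..m}. \<theta> i < \<theta> j}"
      using permutes_image[OF p] by (smt (verit) imageE imageI mem_Collect_eq)
  next
    fix r assume "r \<in> \<theta> ` {j\<in>{1..m}. \<theta> i < \<theta> j}"
    then obtain j where "j \<in> {1..m}" "\<theta> i < \<theta> j" "r = \<theta> j" by auto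
    then show "r \<in> {\<theta> i<..m}" using permutes_in_image[OF p, of j] by auto
  qed
  then have "card {j\<in>{1..m}. \<theta> i < \<theta> j} = card {\<theta> i<..m}"
    using card_image[OF inj_on_subset[OF permutes_inj[OF p] subset_UNIV]] by metis
  then show ?thesis by simp
qed

lemma rank_order_step:
  assumes p: "\<theta> permutes {1..m}"
    and r: "rank_order m \<theta> (\<lambda>i. frac (real i * \<alpha> + \<beta>))"
    and i: "i \<in> {1..m - 1}"
  shows "\<exists>D. [int (\<theta> (i + 1)) - int (\<theta> i) = D] (mod int m) \<and> D \<in> {\<lfloor>m * \<alpha>\<rfloor>, \<lfloor>m * \<alpha>\<rfloor> + 1}"
proof -
  define x where "x = (\<lambda>i. frac (real i * \<alpha> + \<beta>))"
  define G where "G = (\<lambda>i. \<Sum>j\<in>{1..m}. frac ((real i - real j) * \<alpha>))"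
  \<comment> \<open>The rank of a point as a sum of fractional parts; the increments of \<open>G\<close> telescope.\<close>
  have rank: "real m - real (\<theta> l) = G l - m * x l + (\<Sum>j\<in>{1..m}. x j)" if l: "l \<in> {1..m}" for l
  proof -
    have eq: "x l < x j \<longleftrightarrow> \<theta> l < \<theta> j" if j: "j \<in> {1..m}" for j
    proof (cases "\<theta> j = \<theta> l")
      case True
      then have "j = l" using permutes_inj[OF p] by (simp add: inj_eq)
      then show ?thesis by simp
    next
      case False
      then show ?thesis using r l j unfolding rank_order_def x_def
        by (meson linorder_neqE_nat order_less_asym)
    qed
    have "real m - real (\<theta> l) = real (card {j\<in>{1..m}. \<theta> l < \<theta> j})"
      using permutes_card_greater[OF p l] permutes_in_image[OF p, of l] l by auto
    also have "\<dots> = (\<Sum>j\<in>{1..m}. of_bool (x l < x j))"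
      using eq by (simp add: sum.If_cases of_bool_def Int_def cong: sum.cong conj_cong)
    also have "\<dots> = (\<Sum>j\<in>{1..m}. frac ((real l - real j) * \<alpha>) - x l + x j)"
    proof (rule sum.cong[OF refl])
      fix j
      have "(real l - real j) * \<alpha> = (real l * \<alpha> + \<beta>) - (real j * \<alpha> + \<beta>)"
        by (simp add: algebra_simps)
      then show "of_bool (x l < x j) = frac ((real l - real j) * \<alpha>) - x l + x j"
        using frac_diff_eq[of "real l * \<alpha> + \<beta>" "real j * \<alpha> + \<beta>"] unfolding x_def by simp
    qed
    finally show ?thesis by (simp add: sum.distrib sum_subtractf G_def)
  qed
  have im: "i \<in> {1..m}" "i + 1 \<in> {1..m}" using i by auto
  \<comment> \<open>The summand of \<open>G (i + 1)\<close> at \<open>j\<close> is that of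
    \<open>G i\<close> at \<open>j - 1\<close>, so only the terms at 0 and \<open>m\<close> survive
    in the difference.\<close>
  define g where "g = (\<lambda>j::nat. frac ((real i - real j) * \<alpha>))"
  have "G (i + 1) = (\<Sum>j\<in>{1..m}. g (j - 1))"
    unfolding G_def g_def by (rule sum.cong) (auto simp: algebra_simps)
  moreover have "G i = (\<Sum>j\<in>{1..m}. g j)" unfolding G_def g_def ..
  ultimately have "G (i + 1) - G i = (\<Sum>j\<in>{Suc 0..m}. g (j - 1) - g j)"
    by (simp add: sum_subtractf)
  also have "\<dots> = g 0 - g m" using sum_telescope''[of 0 m g] 
    by (simp add: atLeastSucAtMost_greaterThanAtMost sum_subtractf)
  finally have G: "G (i + 1) - G i = g 0 - g m" .
  \<comment> \<open>The integer part lost from \<open>x i\<close> to \<open>x (i + 1)\<close>;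
    weighted by \<open>m\<close> in the rank formula, it vanishes modulo \<open>m\<close>.\<close>
  define c where "c = \<lfloor>real (i + 1) * \<alpha> + \<beta>\<rfloor> - \<lfloor>real i * \<alpha> + \<beta>\<rfloor>"
  have x: "x (i + 1) = x i + \<alpha> - of_int c"
    unfolding x_def c_def frac_def by (simp add: algebra_simps)
  define D where "D = int (\<theta> (i + 1)) - int (\<theta> i) + int m * c"
  have "of_int D = real m * \<alpha> + g m - g 0"
    using rank[OF im(1)] rank[OF im(2)] G unfolding D_def x by (simp add: algebra_simps)
  moreover have "0 \<le> g m" "g m < 1" "0 \<le> g 0" "g 0 < 1"
    unfolding g_def by (auto simp: frac_lt_1)
  ultimately have "of_int D < real m * \<alpha> + 1" "of_int D > real m * \<alpha> - 1" by linarith+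
  then have "D \<in> {\<lfloor>m * \<alpha>\<rfloor>, \<lfloor>m * \<alpha>\<rfloor> + 1}" by (simp; linarith)
  moreover have "[int (\<theta> (i + 1)) - int (\<theta> i) = D] (mod int m)"
    unfolding D_def by (simp add: cong_def)
  ultimately show ?thesis by blast
qed

lemma permutes_step_not_cong_0:
  assumes p: "\<theta> permutes {1..m}" and i: "i \<in> {1..m - 1}"
  shows "(int (\<theta> (i + 1)) - int (\<theta> i)) mod int m \<noteq> 0"
proof
  assume "(int (\<theta> (i + 1)) - int (\<theta> i)) mod int m = 0"
  then have "[int (\<theta> (i + 1)) = int (\<theta> i)] (mod int m)"
    by (simp add: cong_iff_dvd_diff dvd_eq_mod_eq_0)
  moreover have "i \<in> {1..m}" "i + 1 \<in> {1..m}" using i by auto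
  ultimately have "\<theta> (i + 1) = \<theta> i"
    using cong_residue_unique permutes_in_image[OF p] by blast
  then show False using permutes_inj[OF p] by (simp add: inj_eq)
qed

lemma inverses_Sos_type_subset_X:
  assumes m: "m \<ge> 2"
  shows "inverses (Sos_type m) \<subseteq> X m"
proof
  fix \<theta> assume "\<theta> \<in> inverses (Sos_type m)"
  then have p: "\<theta> permutes {1..m}" and "inv \<theta> \<in> Sos_type m"
    by (auto simp: mem_inverses_iff[OF Sos_type_subset_Sym])
  then obtain \<alpha> \<beta> where r: "rank_order m \<theta> (\<lambda>i. frac (real i * \<alpha> + \<beta>))"
    using inv_mem_Sos_type_iff m by auto
  define K where "K = \<lfloor>m * \<alpha>\<rfloor> mod int m"
  have K: "0 \<le> K" "K < int m" using m by (auto simp: K_def)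
  \<comment> \<open>A step is never 0 modulo \<open>m\<close>: for \<open>K = 0\<close> only the
    step 1 remains, and for \<open>K = m - 1\<close> only \<open>K\<close> itself.\<close>
  define k where "k = (if K = 0 then 1 else nat K)"
  have "k \<in> {1..m - 1}" using K m by (auto simp: k_def)
  moreover have "(int (\<theta> (i + 1)) - int (\<theta> i)) mod int m \<in> {int k, int k + 1}"
    if i: "i \<in> {1..m - 1}" for i
  proof -
    let ?d = "(int (\<theta> (i + 1)) - int (\<theta> i)) mod int m"
    obtain D where D: "?d = D mod int m" "D \<in> {\<lfloor>m * \<alpha>\<rfloor>, \<lfloor>m * \<alpha>\<rfloor> + 1}"
      using rank_order_step[OF p r i] by (auto simp: cong_def)
    have "(\<lfloor>m * \<alpha>\<rfloor> + 1) mod int m = (K + 1) mod int m" by (simp add: K_def mod_simps)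
    also have "\<dots> = (if K + 1 = int m then 0 else K + 1)" using K by auto
    finally have "?d = K \<or> ?d = (if K + 1 = int m then 0 else K + 1)"
      using D K_def by auto
    then show ?thesis using permutes_step_not_cong_0[OF p i] K
      by (auto simp: k_def split: if_splits)
  qed
  ultimately show "\<theta> \<in> X m" using p unfolding X_def Sym_def by blast
qed

section \<open>Shifts\<close>

lemma shift_permutation:
  assumes p: "\<theta> permutes {1..m}" and m: "m \<ge> 1"
  obtains \<theta>' where "\<theta>' permutes {1..m}" "\<And>i. i \<in> {1..m} \<Longrightarrow> [int (\<theta>' i) = int (\<theta> i) + e] (mod int m)"
proof -
  have "\<forall>i. \<exists>v. v \<in> {1..m} \<and> [int v = int (\<theta> i) + e] (mod int m)"
    using residue_representative[OF m] by metis
  then obtain f where f: "\<And>i. f i \<in> {1..m}" "\<And>i. [int (f i) = int (\<theta> i) + e] (mod int m)"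
    by metis
  define \<theta>' where "\<theta>' = (\<lambda>i. if i \<in> {1..m} then f i else i)"
  have "inj_on f {1..m}"
  proof (rule inj_onI)
    fix i j assume ij: "i \<in> {1..m}" "j \<in> {1..m}" "f i = f j"
    have "[int (\<theta> i) + e = int (\<theta> j) + e] (mod int m)"
      using f(2)[of i] f(2)[of j] ij(3) by (metis cong_sym cong_trans)
    then have "\<theta> i = \<theta> j"
      using cong_residue_unique permutes_in_image[OF p] ij(1,2) by (metis cong_add_rcancel)
    then show "i = j" using permutes_inj[OF p] by (simp add: inj_eq)
  qed
  then have "inj_on \<theta>' {1..m}" using inj_on_cong[of "{1..m}" \<theta>' f] by (simp add: \<theta>'_def)
  moreover have "\<theta>' ` {1..m} \<subseteq> {1..m}" using f(1) by (auto simp: \<theta>'_def)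
  ultimately have "bij_betw \<theta>' {1..m} {1..m}"
    by (metis bij_betw_def endo_inj_surj finite_atLeastAtMost)
  then have "\<theta>' permutes {1..m}" by (rule bij_imp_permutes) (auto simp: \<theta>'_def)
  moreover have "[int (\<theta>' i) = int (\<theta> i) + e] (mod int m)" if "i \<in> {1..m}" for i
    using f(2) that by (simp add: \<theta>'_def)
  ultimately show ?thesis using that by blast
qed

text \<open>Adding \<open>c\<close> to the ranks moves the top \<open>c\<close> points to the
  bottom. Rotating the circle by \<open>1 - y\<close> does the same if \<open>y\<close> lies in the
  gap between ranks \<open>m - c\<close> and \<open>m - c + 1\<close>.\<close>

lemma shift_closure_inverses_Sos_subset:
  assumes m: "m \<ge> 1"
  shows "shift_closure m (inverses (Sos m)) \<subseteq> inverses (Sos_type m)"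
proof
  fix \<theta>' assume "\<theta>' \<in> shift_closure m (inverses (Sos m))"
  then obtain \<theta> c where p': "\<theta>' permutes {1..m}" and th: "\<theta> \<in> inverses (Sos m)"
      and c: "c \<in> {1..m}" "\<And>i. i \<in> {1..m} \<Longrightarrow> [\<theta>' i = \<theta> i + c] (mod m)"
    unfolding shift_closure_def shift_equivalent_def Sym_def by blast
  have p: "\<theta> permutes {1..m}" using th by (simp add: mem_inverses_iff[OF Sos_subset_Sym])
  obtain \<alpha> where r: "rank_order m \<theta> (\<lambda>i. frac (real i * \<alpha>))"
    using th inv_mem_Sos_iff[OF p m] by (auto simp: mem_inverses_iff[OF Sos_subset_Sym])
  define x where "x = (\<lambda>i. frac (real i * \<alpha>))"
  have x0: "0 < x i" if "i \<in> {1..m}" for i using r that unfolding rank_order_def x_def by blast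
  have x1: "x i < 1" for i by (simp add: x_def frac_lt_1)
  have mono: "x i < x j" if "i \<in> {1..m}" "j \<in> {1..m}" "\<theta> i < \<theta> j" for i j
    using r that unfolding rank_order_def x_def by blast
  have img: "\<theta> i \<in> {1..m}" "\<theta>' i \<in> {1..m}" if "i \<in> {1..m}" for i
    using permutes_in_image[OF p] permutes_in_image[OF p'] that by blast+
  define h where "h = m - c"
  have eq: "\<theta>' i = (if \<theta> i \<le> h then \<theta> i + c else \<theta> i - h)" if i: "i \<in> {1..m}" for i
  proof (rule cong_residue_unique[of _ _ m])
    have *: "[int (\<theta>' i) = int (\<theta> i) + int c] (mod int m)"
      using c(2)[OF i] by (simp flip: cong_int_iff)
    show "[int (\<theta>' i) = int (if \<theta> i \<le> h then \<theta> i + c else \<theta> i - h)] (mod int m)"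
    proof (cases "\<theta> i \<le> h")
      case True
      then show ?thesis using * by simp
    next
      case False
      have "[int (\<theta>' i) = int (\<theta> i) + int c - int m] (mod int m)"
        using * by (simp add: cong_def)
      moreover have "int (\<theta> i - h) = int (\<theta> i) + int c - int m"
        using False c(1) by (auto simp: h_def)
      ultimately show ?thesis using False by (simp only: if_False)
    qed
    show "\<theta>' i \<in> {1..m}" "(if \<theta> i \<le> h then \<theta> i + c else \<theta> i - h) \<in> {1..m}"
      using img[OF i] c(1) by (auto simp: h_def)
  qed
  have "\<exists>y. 0 \<le> y \<and> y < 1 \<and> (\<forall>i\<in>{1..m}. if \<theta> i \<le> h then x i < y else y < x i)"
  \<comment> \<open>For \<open>h = 0\<close> every point must lie above \<open>y\<close>, and
    \<open>y = 0\<close> works; otherwise take the midpoint of the gap.\<close>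
  proof (cases "h = 0")
    case True
    then show ?thesis using x0 img by (intro exI[of _ 0]) fastforce
  next
    case False
    have hm: "h \<in> {1..m}" "h + 1 \<in> {1..m}" using False c(1) by (auto simp: h_def)
    obtain u v where uv: "u \<in> {1..m}" "\<theta> u = h" "v \<in> {1..m}" "\<theta> v = h + 1"
      using hm permutes_image[OF p] by (metis imageE)
    define y where "y = (x u + x v) / 2"
    have "x u < y" "y < x v" using mono[OF uv(1,3)] uv by (auto simp: y_def)
    moreover have "if \<theta> i \<le> h then x i \<le> x u else x v \<le> x i" if i: "i \<in> {1..m}" for i
    proof (cases "\<theta> i = \<theta> u \<or> \<theta> i = \<theta> v")
      case True
      then have "i = u \<or> i = v" using permutes_inj[OF p] by (simp add: inj_eq)
      then show ?thesis using uv by auto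
    next
      case False
      then show ?thesis using mono[OF i uv(1)] mono[OF uv(3) i] uv by auto
    qed
    ultimately show ?thesis using x0[OF uv(1)] x1[of v]
      by (intro exI[of _ y]) (smt (verit))
  qed
  then obtain y where y: "0 \<le> y" "y < 1"
    "\<And>i. i \<in> {1..m} \<Longrightarrow> if \<theta> i \<le> h then x i < y else y < x i" by blast
  have fr: "frac (real i * \<alpha> + (1 - y)) = x i - y + of_bool (\<theta> i \<le> h)" if i: "i \<in> {1..m}" for i
  proof -
    have "real i * \<alpha> + (1 - y) - (x i - y + of_bool (\<theta> i \<le> h)) \<in> \<int>"
      by (auto simp: x_def frac_def)
    then show ?thesis
      using y(1,2) y(3)[OF i] x0[OF i] x1[of i] by (simp add: frac_unique_iff split: if_splits)
  qed
  have "rank_order m \<theta>' (\<lambda>i. frac (real i * \<alpha> + (1 - y)))"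
    unfolding rank_order_def
  proof (intro conjI ballI impI)
    fix i assume i: "i \<in> {1..m}"
    show "0 < frac (real i * \<alpha> + (1 - y))"
      using fr[OF i] y(2) y(3)[OF i] x0[OF i] by (auto split: if_splits)
    fix j assume j: "j \<in> {1..m}" and less: "\<theta>' i < \<theta>' j"
    show "frac (real i * \<alpha> + (1 - y)) < frac (real j * \<alpha> + (1 - y))"
      unfolding fr[OF i] fr[OF j]
      using less eq[OF i] eq[OF j] img(1)[OF i] img(1)[OF j] y(3)[OF i] y(3)[OF j] x0[OF j] x1[of i]
        mono[OF i j] c(1)
      by (auto simp: h_def split: if_splits)
  qed
  then show "\<theta>' \<in> inverses (Sos_type m)"
    using inv_mem_Sos_type_iff[OF p' m] p' by (auto simp: mem_inverses_iff[OF Sos_type_subset_Sym])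
qed

section \<open>Quasi-progressions in normal form\<close>

locale normal_quasi_progression =
  fixes m k :: nat and \<theta> :: "nat \<Rightarrow> nat"
  assumes m: "m \<ge> 2" and k: "k \<in> {1..m - 1}" and perm: "\<theta> permutes {1..m}"
    and first: "\<theta> 1 = k + 1"
    and step: "i \<in> {1..m - 1} \<Longrightarrow>
      [int (\<theta> (i + 1)) = int (\<theta> i) + int k + of_bool (\<theta> i < \<theta> m)] (mod int m)"
begin

text \<open>\<open>a\<close> and \<open>b\<close> are the indices of the two neighbours of the point
  0 on the circle, as in the three-gap theorem.\<close>

definition a where "a = inv \<theta> 1"
definition b where "b = inv \<theta> m"

lemma image: "i \<in> {1..m} \<Longrightarrow> \<theta> i \<in> {1..m}"
  using permutes_in_image[OF perm] by blast

lemma theta_eq: "\<theta> i = \<theta> j \<longleftrightarrow> i = j"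
  using permutes_inj[OF perm] by (simp add: inj_eq)

lemma theta_0: "\<theta> 0 = 0"
  by (rule permutes_not_in[OF perm]) simp

lemma theta_a: "\<theta> a = 1" and theta_b: "\<theta> b = m"
  by (simp_all add: a_def b_def permutes_inverses(1)[OF perm])

lemma a_range: "a \<in> {1..m}" and b_range: "b \<in> {1..m}"
  unfolding a_def b_def using permutes_in_image[OF permutes_inv[OF perm]] m by auto

text \<open>With index 0 counted as a point of rank 0, the assumption \<open>first\<close> is the
  step rule at 0.\<close>

lemma step_le:
  assumes "i < m"
  shows "[int (\<theta> (i + 1)) = int (\<theta> i) + int k + of_bool (\<theta> i < \<theta> m)] (mod int m)"
proof (cases "i = 0")
  case True
  then show ?thesis using first theta_0 image[of m] m by (simp add: add.commute)
next
  case False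
  then show ?thesis using step[of i] assms by simp
qed

text \<open>Consecutive ranks stay cyclically consecutive when both indices advance, since only the
  value \<open>\<theta> m\<close> separates the two step sizes.\<close>

lemma advance:
  assumes "i < m" "j < m" "\<theta> j = \<theta> i + 1"
  shows "if i + 1 = b then j + 1 = a else \<theta> (j + 1) = \<theta> (i + 1) + 1"
proof -
  have "\<theta> j \<noteq> \<theta> m" using assms(2) theta_eq by auto
  then have "(\<theta> j < \<theta> m) = (\<theta> i < \<theta> m)" using assms(3) by auto
  then have "[int (\<theta> (j + 1)) = int (\<theta> i) + int k + of_bool (\<theta> i < \<theta> m) + 1] (mod int m)"
    using step_le[OF assms(2)] assms(3) by (simp add: algebra_simps)
  moreover have "[int (\<theta> (i + 1)) + 1 = int (\<theta> i) + int k + of_bool (\<theta> i < \<theta> m) + 1] (mod int m)"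
    using step_le[OF assms(1)] cong_add_rcancel by blast
  ultimately have c: "[int (\<theta> (j + 1)) = int (\<theta> (i + 1)) + 1] (mod int m)"
    by (metis cong_sym cong_trans)
  have j: "\<theta> (j + 1) \<in> {1..m}" and i: "\<theta> (i + 1) \<in> {1..m}" using image assms by auto
  show ?thesis
  proof (cases "i + 1 = b")
    \<comment> \<open>Rank \<open>m\<close> is followed cyclically by rank 1, which belongs to
      \<open>a\<close>.\<close>
    case True
    then have "[int (\<theta> (j + 1)) = int 1] (mod int m)" using c theta_b by (simp add: cong_def)
    then have "\<theta> (j + 1) = \<theta> a" using cong_residue_unique[OF _ j] m theta_a by auto
    then show ?thesis using True theta_eq by simp
  next
    case False
    then have "\<theta> (i + 1) \<noteq> m" using theta_eq[of "i + 1" b] theta_b by auto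
    then have "\<theta> (j + 1) = \<theta> (i + 1) + 1"
      using c i cong_residue_unique[OF _ j, of "\<theta> (i + 1) + 1"] by (auto simp: add.commute)
    then show ?thesis using False by simp
  qed
qed

section \<open>Index differences between consecutive ranks\<close>

lemma theta_add_a: "i + a \<le> m \<Longrightarrow> \<theta> (i + a) = \<theta> i + 1"
proof (induction i)
  case 0
  then show ?case using theta_a theta_0 by simp
next
  case (Suc i)
  \<comment> \<open>The exceptional case of \<open>advance\<close> would need
    \<open>i + a + 1 = a\<close>.\<close>
  then show ?case using advance[of i "i + a"] a_range by (auto split: if_splits)
qed

text \<open>The top rank \<open>m\<close> at \<open>b\<close> takes a short step and wraps to
  \<open>k\<close>, one below \<open>\<theta> 1\<close>. This starts the induction, at index 1
  instead of 0.\<close>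

lemma theta_add_b: "i + 1 + b \<le> m \<Longrightarrow> \<theta> (i + 1) = \<theta> (i + 1 + b) + 1"
proof (induction i)
  case 0
  have "\<not> \<theta> b < \<theta> m" using theta_b image[of m] m by auto
  then have "[int (\<theta> (b + 1)) = int k] (mod int m)"
    using step[of b] b_range 0 theta_b by (auto simp: cong_def)
  then have "\<theta> (b + 1) = k" using cong_residue_unique[of "\<theta> (b + 1)" k m] image[of "b + 1"] 0 k by auto
  then show ?case using first by (simp add: add.commute)
next
  case (Suc i)
  then show ?case using advance[of "i + 1 + b" "i + 1"] by (auto split: if_splits)
qed

lemma m_less_ab: "m < a + b"
proof (rule ccontr)
  assume "\<not> m < a + b"
  then have "\<theta> (b + a) = m + 1" "b + a \<in> {1..m}"
    using theta_add_a[of b] theta_b b_range by (auto simp: add.commute)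
  then show False using image[of "b + a"] by auto
qed

text \<open>Here neither \<open>i + a\<close> nor \<open>i - b\<close> is an available index.
  Advancing both indices keeps \<open>j - i\<close> fixed until \<open>i\<close> reaches
  \<open>b\<close>, where \<open>j\<close> must reach \<open>a\<close>.\<close>

lemma middle:
  assumes "m < i + a" "i < b" "j \<le> m" "\<theta> j = \<theta> i + 1"
  shows "j + b = i + a"
  using assms
proof (induction "b - i" arbitrary: i j)
  case (Suc d)
  \<comment> \<open>Index \<open>m\<close> cannot be advanced, but its predecessor in rank is
    \<open>m - a\<close>, which is too small to be \<open>i\<close>.\<close>
  have "j \<noteq> m"
  proof
    assume "j = m"
    then have "\<theta> (m - a) = \<theta> i" using theta_add_a[of "m - a"] a_range Suc.prems by auto
    then have "m - a = i" using theta_eq by blast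
    then show False using Suc.prems(1) a_range by auto
  qed
  then have j: "j < m" using Suc.prems by simp
  have i: "i < m" using Suc.prems b_range by auto
  show ?case
  proof (cases "i + 1 = b")
    case True
    then show ?thesis using advance[OF i j Suc.prems(4)] by auto
  next
    case False
    then have "\<theta> (j + 1) = \<theta> (i + 1) + 1" using advance[OF i j Suc.prems(4)] by auto
    then have "(j + 1) + b = (i + 1) + a"
      using Suc.hyps(1)[of "i + 1" "j + 1"] Suc.hyps(2) Suc.prems False j by auto
    then show ?thesis by simp
  qed
qed simp

text \<open>The differences \<open>a\<close>, \<open>-b\<close> and \<open>a - b\<close> are
  \<open>a\<close>, \<open>a\<close> and \<open>2 * a\<close> modulo \<open>a + b\<close>; the top
  rank at \<open>b\<close> has no successor.\<close>

lemma successor: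
  assumes "i \<le> m" "j \<le> m" "\<theta> j = \<theta> i + 1"
  obtains t where "t \<in> {1, 2}" "[j = i + t * a] (mod (a + b))"
proof -
  consider "i + a \<le> m" | "b < i" | "m < i + a" "i < b" | "i = b" by linarith
  then show ?thesis
  proof cases
    case 1
    then have "\<theta> j = \<theta> (i + 1 * a)" using theta_add_a[of i] assms(3) by simp
    then have "j = i + 1 * a" using theta_eq by blast
    then show ?thesis using that[of 1] by simp
  next
    case 2
    then have "\<theta> (i - b) = \<theta> i + 1" using theta_add_b[of "i - b - 1"] assms(1) by (auto simp: Suc_diff_Suc)
    then have "j = i - b" using assms(3) theta_eq by metis
    then have "j + (a + b) = i + 1 * a" using 2 by simp
    then have "[j = i + 1 * a] (mod (a + b))" by (metis cong_def mod_add_self2)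
    then show ?thesis using that[of 1] by simp
  next
    case 3
    then have "j + (a + b) = i + 2 * a" using middle assms by fastforce
    then have "[j = i + 2 * a] (mod (a + b))" by (metis cong_def mod_add_self2)
    then show ?thesis using that[of 2] by simp
  next
    case 4
    then have "\<theta> j = m + 1" using assms(3) theta_b by simp
    then show ?thesis using image[of j] assms(2) theta_0 by (cases "j = 0") auto
  qed
qed

section \<open>A unit modulo \<open>a + b\<close> and the resulting slope\<close>

lemma inv_range: "r \<le> m \<Longrightarrow> inv \<theta> r \<le> m"
  using permutes_in_image[OF permutes_inv[OF perm], of r] permutes_not_in[OF permutes_inv[OF perm], of r]
  by (cases "r = 0") auto

lemma theta_inv: "\<theta> (inv \<theta> r) = r"
  by (simp add: permutes_inverses(1)[OF perm])

text \<open>Starting from index 0 and following successors, a common divisor of \<open>a\<close> and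
  \<open>a + b\<close> divides every index reached. Index 1 is among them.\<close>

lemma coprime_ab: "coprime a (a + b)"
proof -
  define g where "g = gcd a (a + b)"
  have g: "g dvd a" "g dvd a + b" by (auto simp: g_def)
  have "g dvd inv \<theta> r" if "r \<le> m" for r
    using that
  proof (induction r)
    case 0
    have "inv \<theta> 0 = 0" using theta_0 by (metis theta_eq theta_inv)
    then show ?case by simp
  next
    case (Suc r)
    have "inv \<theta> r \<le> m" "inv \<theta> (Suc r) \<le> m" "\<theta> (inv \<theta> (Suc r)) = \<theta> (inv \<theta> r) + 1"
      using inv_range theta_inv Suc.prems by auto
    then obtain t where "[inv \<theta> (Suc r) = inv \<theta> r + t * a] (mod (a + b))"
      using successor by metis
    then have "[inv \<theta> (Suc r) = inv \<theta> r + t * a] (mod g)"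
      using g(2) cong_dvd_modulus_nat by blast
    moreover have "g dvd inv \<theta> r + t * a" using g(1) Suc by simp
    ultimately show ?case using cong_dvd_iff by blast
  qed
  then have "g dvd inv \<theta> (\<theta> 1)" using image[of 1] m by auto
  then have "g = 1" by (simp add: permutes_inverses(2)[OF perm])
  then show ?thesis by (simp add: g_def coprime_iff_gcd_eq_1)
qed

text \<open>The slope is \<open>U / (a + b)\<close> where \<open>U\<close> inverts \<open>a\<close>, so that passing to the successor increases
  the residue of \<open>i * U\<close> by 1 or 2. The residue cannot wrap around, because that would
  make the successor 0 or the successor of 0.\<close>

lemma inv_mem_Sos: "inv \<theta> \<in> Sos m"
proof -
  define n where "n = a + b"
  have n: "n > m" "n > 2" using m_less_ab m by (auto simp: n_def)
  obtain U where U: "[a * U = 1] (mod n)"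
    using cong_solve_coprime_nat[OF coprime_ab] by (auto simp: n_def)
  define f where "f = (\<lambda>i. (i * U) mod n)"
  \<comment> \<open>Multiplying by \<open>a\<close> undoes \<open>U\<close>, and indices up to
    \<open>m < n\<close> are determined modulo \<open>n\<close>.\<close>
  have f_inj: "i = j" if "f i = f j" "i \<le> m" "j \<le> m" for i j
  proof -
    have "[i * U = j * U] (mod n)" using that(1) by (simp add: f_def cong_def)
    then have "[i * U * a = j * U * a] (mod n)" by (rule cong_scalar_right)
    moreover have "[l * U * a = l] (mod n)" for l
      using cong_scalar_left[OF U, of l] by (simp add: mult.assoc mult.commute[of U])
    ultimately have "[i = j] (mod n)" by (metis cong_sym cong_trans)
    then show ?thesis using that n(1) by (simp add: cong_def)
  qed
  have fa: "f a = 1" using U n by (simp add: f_def cong_def)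
  have f0: "f 0 = 0" by (simp add: f_def)
  have mono: "f (inv \<theta> r) < f (inv \<theta> (r + 1))" if r: "r \<in> {1..m - 1}" for r
  proof -
    let ?i = "inv \<theta> r" and ?j = "inv \<theta> (r + 1)"
    have le: "?i \<le> m" "?j \<le> m" using inv_range[of r] inv_range[of "r + 1"] r by auto
    obtain t where t: "t \<in> {1, 2}" "[?j = ?i + t * a] (mod n)"
      using successor[OF le] theta_inv[of r] theta_inv[of "r + 1"] unfolding n_def by metis
    have "[?j * U = (?i + t * a) * U] (mod n)" using t(2) by (rule cong_scalar_right)
    moreover have "[?i * U + t * (a * U) = ?i * U + t * 1] (mod n)"
      using U by (intro cong_add cong_mult cong_refl)
    ultimately have "[?j * U = ?i * U + t] (mod n)"
      by (simp add: algebra_simps) (metis cong_trans)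
    then have ft: "f ?j = (f ?i + t) mod n" by (simp add: f_def cong_def mod_simps)
    \<comment> \<open>Since \<open>t \<le> 2\<close>, a wrap could only produce the residues 0 and
      1, which belong to the indices 0 and \<open>a\<close> of ranks 0 and 1; here the rank is at
      least 2.\<close>
    have "\<theta> ?j \<noteq> \<theta> 0" "\<theta> ?j \<noteq> \<theta> a" using r by (simp_all only: theta_inv theta_0 theta_a) auto
    then have "?j \<noteq> 0" "?j \<noteq> a" by metis+
    then have "f ?j \<noteq> 0" "f ?j \<noteq> 1" using f_inj[of ?j 0] f_inj[of ?j a] f0 fa le(2) a_range by auto
    moreover have "f ?i < n" using n by (simp add: f_def)
    moreover have "(f ?i + t) mod n = (if f ?i + t < n then f ?i + t else f ?i + t - n)"
      using \<open>f ?i < n\<close> t(1) n by (auto simp: le_mod_geq)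
    ultimately show ?thesis using ft t(1) by (auto split: if_splits)
  qed
  have fr: "frac (real i * (real U / real n)) = real (f i) / real n" for i
  proof -
    have "\<lfloor>real (i * U) / real n\<rfloor> = int ((i * U) div n)" by (rule floor_divide_of_nat_eq)
    moreover have "real (i * U) / real n = real ((i * U) div n) + real (f i) / real n"
      unfolding f_def by (rule of_nat_of_nat_div_aux)
    ultimately show ?thesis by (simp add: frac_def)
  qed
  have "rank_order m \<theta> (\<lambda>i. frac (real i * (real U / real n)))"
    using fa mono n m unfolding rank_order_iff_chain[OF perm order_trans[OF one_le_numeral m]] fr a_def
    by (simp add: divide_strict_right_mono)
  then show ?thesis using inv_mem_Sos_iff[OF perm order_trans[OF one_le_numeral m]] by blast
qed

end

section \<open>Normalisation by a shift\<close>

text \<open>The values with a long step \<open>k + 1\<close> form a run of length \<open>s\<close>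
  just below \<open>\<theta> m\<close>, cyclically. The shift carries this run to the ranks 1 to
  \<open>s\<close>.\<close>

lemma X_shift_normal:
  assumes m: "m \<ge> 2" and X: "\<theta> \<in> X m"
  obtains k \<theta>' where "normal_quasi_progression m k \<theta>'" "shift_equivalent m \<theta>' \<theta>"
proof -
  define d where "d = (\<lambda>i. (int (\<theta> (i + 1)) - int (\<theta> i)) mod int m)"
  obtain k where p: "\<theta> permutes {1..m}" and k: "k \<in> {1..m - 1}"
    and dk: "\<And>i. i \<in> {1..m - 1} \<Longrightarrow> d i = int k \<or> d i = int k + 1"
    using X unfolding X_def Sym_def d_def by auto
  have d_step: "[int (\<theta> (i + 1)) = int (\<theta> i) + d i] (mod int m)" for i
    by (simp add: d_def cong_def mod_simps)
  have img: "\<theta> i \<in> {1..m}" if "i \<in> {1..m}" for i using permutes_in_image[OF p] that by blast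
  have cong_eq: "i = j" if "[int (\<theta> i) = int (\<theta> j)] (mod int m)" "i \<in> {1..m}" "j \<in> {1..m}" for i j
    using cong_residue_unique[OF that(1) img[OF that(2)] img[OF that(3)]] permutes_inj[OF p]
    by (simp add: inj_eq)
  have surj: "\<exists>i\<in>{1..m}. [int (\<theta> i) = r] (mod int m)" for r
  proof -
    obtain v where "v \<in> {1..m}" "[int v = r] (mod int m)"
      using residue_representative[of m r] m by auto
    then show ?thesis using permutes_image[OF p] by (metis imageE)
  qed
  have not_1: "\<not> [r = r + 1] (mod int m)" for r
    using m by (simp add: cong_iff_dvd_diff)
  \<comment> \<open>Otherwise \<open>i\<close> and \<open>j\<close> would have congruent images one step later.\<close>
  have key: False if "i \<in> {1..m - 1}" "j \<in> {1..m - 1}" "d i = int k + 1" "d j = int k"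
    "[int (\<theta> j) = int (\<theta> i) + 1] (mod int m)" for i j
  proof -
    have "[int (\<theta> (j + 1)) = int (\<theta> j) + int k] (mod int m)" using d_step[of j] that(4) by simp
    also have "[int (\<theta> j) + int k = int (\<theta> i) + 1 + int k] (mod int m)"
      using that(5) cong_add_rcancel by blast
    also have "[int (\<theta> i) + 1 + int k = int (\<theta> (i + 1))] (mod int m)"
      using cong_sym[OF d_step[of i]] that(3) by (simp add: algebra_simps)
    finally have "j + 1 = i + 1" using cong_eq[of "j + 1" "i + 1"] that(1,2) by auto
    then show False using that(5) not_1[of "int (\<theta> i)"] by simp
  qed
  define q where "q = int (\<theta> m)"
  \<comment> \<open>\<open>P u\<close> says that the value \<open>u\<close> places below
    \<open>q\<close> takes a long step; \<open>s\<close> is the length of the initial run of such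
    \<open>u\<close>.\<close>
  define P where "P = (\<lambda>u::nat. \<exists>i\<in>{1..m - 1}. [int (\<theta> i) = q - int u] (mod int m) \<and> d i = int k + 1)"
  define s where "s = (LEAST s. \<not> P (s + 1))"
  \<comment> \<open>At distance \<open>m\<close> the value is \<open>q\<close> again, taken only at
    index \<open>m\<close>, so the run ends before.\<close>
  have "\<not> P (m - 1 + 1)"
  proof
    assume "P (m - 1 + 1)"
    then obtain i where i: "i \<in> {1..m - 1}" "[int (\<theta> i) = q] (mod int m)"
      using m unfolding P_def by (auto simp: cong_def)
    then have "i = m" using cong_eq[of i m] unfolding q_def by auto
    then show False using i by auto
  qed
  then have s: "\<not> P (s + 1)" "s \<le> m - 1"
    unfolding s_def by (rule LeastI, rule Least_le)
  have P: "P u" if "1 \<le> u" "u \<le> s" for u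
    using not_less_Least[of "u - 1" "\<lambda>s. \<not> P (s + 1)"] that unfolding s_def by auto
  have A: "d i = int k + 1"
    if "i \<in> {1..m - 1}" "1 \<le> u" "u \<le> s" "[int (\<theta> i) = q - int u] (mod int m)" for i u
  proof -
    have "P u" using P that(2,3) by blast
    then obtain j where j: "j \<in> {1..m - 1}" "[int (\<theta> j) = q - int u] (mod int m)" "d j = int k + 1"
      unfolding P_def by blast
    have "[int (\<theta> i) = int (\<theta> j)] (mod int m)" using j(2) that(4) by (metis cong_sym cong_trans)
    then have "i = j" using cong_eq[of i j] that(1) j(1) by auto
    then show ?thesis using j by simp
  qed
  \<comment> \<open>Below the run, short steps propagate downwards: by \<open>key\<close>, a value
    just below one with a short step cannot take a long step.\<close>
  have B: "d i = int k"
    if "i \<in> {1..m - 1}" "s + 1 + t < m" "[int (\<theta> i) = q - int (s + 1 + t)] (mod int m)" for i t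
    using that
  proof (induction t arbitrary: i)
    case 0
    then show ?case using s(1) dk[of i] unfolding P_def by auto
  next
    case (Suc t)
    obtain j where j: "j \<in> {1..m}" "[int (\<theta> j) = q - int (s + 1 + t)] (mod int m)"
      using surj by blast
    have "j \<noteq> m"
    proof
      assume "j = m"
      then have "int m dvd int (s + 1 + t)" using j(2) unfolding q_def
        by (simp add: cong_iff_dvd_diff)
      then show False using Suc.prems(2) by (simp add: nat_dvd_not_less flip: of_nat_add of_nat_Suc)
    qed
    then have jm: "j \<in> {1..m - 1}" using j by auto
    have dj: "d j = int k" using Suc.IH[OF jm _ j(2)] Suc.prems(2) by simp
    have "[int (\<theta> i) + 1 = q - int (s + 1 + Suc t) + 1] (mod int m)"
      using Suc.prems(3) cong_add_rcancel by blast
    then have "[int (\<theta> j) = int (\<theta> i) + 1] (mod int m)"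
      using j(2) by (simp add: algebra_simps cong_def)
    then have "d i \<noteq> int k + 1" using key[OF Suc.prems(1) jm _ dj] by blast
    then show ?case using dk[OF Suc.prems(1)] by simp
  qed
  \<comment> \<open>This shift sends \<open>q\<close> to \<open>s + 1\<close>, hence
    \<open>q - u\<close> to \<open>s + 1 - u\<close>.\<close>
  obtain \<theta>' where p': "\<theta>' permutes {1..m}"
    and e: "\<And>i. i \<in> {1..m} \<Longrightarrow> [int (\<theta>' i) = int (\<theta> i) + (int s + 1 - q)] (mod int m)"
    using shift_permutation[OF p, of "int s + 1 - q"] m by auto
  have img': "\<theta>' i \<in> {1..m}" if "i \<in> {1..m}" for i using permutes_in_image[OF p'] that by blast
  have e': "[int (\<theta> i) = int (\<theta>' i) + (q - int s - 1)] (mod int m)" if "i \<in> {1..m}" for i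
    using cong_add[OF cong_sym[OF e[OF that]] cong_refl[of "q - int s - 1"]] by (simp add: algebra_simps)
  have "[int (\<theta>' m) = int (s + 1)] (mod int m)" using e[of m] m unfolding q_def by (simp add: add.commute)
  then have last: "\<theta>' m = s + 1"
    by (rule cong_residue_unique) (use img'[of m] m s(2) in auto)
  have step: "[int (\<theta>' (i + 1)) = int (\<theta>' i) + int k + of_bool (\<theta>' i < \<theta>' m)] (mod int m)"
    if i: "i \<in> {1..m - 1}" for i
  proof -
    have im: "i \<in> {1..m}" "i + 1 \<in> {1..m}" using i by auto
    have ne: "\<theta>' i \<noteq> \<theta>' m" using permutes_inj[OF p'] i by (auto simp: inj_eq)
    have di: "d i = int k + of_bool (\<theta>' i < \<theta>' m)"
    proof (cases "\<theta>' i < \<theta>' m")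
      case True
      then have "int (\<theta>' i) + (q - int s - 1) = q - int (s + 1 - \<theta>' i)" using last by simp
      then have "[int (\<theta> i) = q - int (s + 1 - \<theta>' i)] (mod int m)" using e'[OF im(1)] by metis
      from A[OF i _ _ this] have "d i = int k + 1" using True last img'[OF im(1)] by auto
      then show ?thesis using True by simp
    next
      case False
      \<comment> \<open>A rank \<open>r\<close> above \<open>s + 1\<close> lies
        \<open>s + 1 + (m - r)\<close> places below \<open>q\<close> cyclically, which is the form
        required by \<open>B\<close>.\<close>
      have "int (\<theta>' i) + (q - int s - 1) = q - int (s + 1 + (m - \<theta>' i)) + int m"
        using img'[OF im(1)] by auto
      then have "[int (\<theta> i) = q - int (s + 1 + (m - \<theta>' i))] (mod int m)"
        using e'[OF im(1)] by (simp only: cong_def mod_add_self2)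
      from B[OF i _ this] have "d i = int k" using False ne last img'[OF im(1)] by auto
      then show ?thesis using False by simp
    qed
    have "[int (\<theta>' (i + 1)) = int (\<theta> i) + d i + (int s + 1 - q)] (mod int m)"
      using e[OF im(2)] d_step[of i] by (meson cong_add_rcancel cong_trans)
    moreover have "[int (\<theta>' i) + d i = int (\<theta> i) + (int s + 1 - q) + d i] (mod int m)"
      using e[OF im(1)] cong_add_rcancel by blast
    ultimately have "[int (\<theta>' (i + 1)) = int (\<theta>' i) + d i] (mod int m)"
      by (simp add: algebra_simps cong_def)
    then show ?thesis using di by (simp add: add.assoc)
  qed
  \<comment> \<open>The value \<open>k + 1\<close> is not reached by any step, so it is taken first.\<close>
  have first: "\<theta>' 1 = k + 1"
  proof -
    have "k + 1 \<in> {1..m}" using k by auto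
    then obtain i where i: "i \<in> {1..m}" "\<theta>' i = k + 1" using permutes_image[OF p'] by (metis imageE)
    have "i = 1"
    proof (rule ccontr)
      assume "i \<noteq> 1"
      define l where "l = i - 1"
      have l: "l \<in> {1..m - 1}" "l \<in> {1..m}" "i = l + 1" using i \<open>i \<noteq> 1\<close> by (auto simp: l_def)
      have ne: "\<theta>' l \<noteq> \<theta>' m" using permutes_inj[OF p'] l by (auto simp: inj_eq)
      have c: "[int k + 1 = int (\<theta>' l) + int k + of_bool (\<theta>' l < \<theta>' m)] (mod int m)"
        using step[OF l(1)] i(2) l(3) by (simp add: add.commute)
      \<comment> \<open>A long step to \<open>k + 1\<close> would start at rank \<open>m\<close>,
        which is not below \<open>\<theta>' m\<close>; a short one would start at rank 1, which is
        either below \<open>\<theta>' m\<close> or equal to it.\<close>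
      show False
      proof (cases "\<theta>' l < \<theta>' m")
        case True
        then have "int m dvd int (\<theta>' l)" using c by (simp add: cong_iff_dvd_diff)
        then show False using True img'[OF l(2)] img'[of m] m by (auto dest: dvd_imp_le)
      next
        case False
        then have "[int 1 = int (\<theta>' l)] (mod int m)" using c by (simp add: cong_iff_dvd_diff)
        then have "\<theta>' l = 1" using cong_residue_unique[of 1 "\<theta>' l" m] img'[OF l(2)] m by auto
        then show False using False ne img'[of m] m by auto
      qed
    qed
    then show ?thesis using i by simp
  qed
  have "normal_quasi_progression m k \<theta>'"
    using m k p' first step by unfold_locales auto
  moreover have "shift_equivalent m \<theta>' \<theta>"
  proof -
    obtain c where c: "c \<in> {1..m}" "[int c = q - int s - 1] (mod int m)"
      using residue_representative[of m "q - int s - 1"] m by auto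
    have "[\<theta> i = \<theta>' i + c] (mod m)" if "i \<in> {1..m}" for i
    proof -
      have "[int (\<theta> i) = int (\<theta>' i) + int c] (mod int m)"
        using e'[OF that] c(2) by (meson cong_add_lcancel cong_sym cong_trans)
      then show ?thesis by (simp flip: cong_int_iff)
    qed
    then show ?thesis using c(1) unfolding shift_equivalent_def by blast
  qed
  ultimately show ?thesis using that by blast
qed

lemma X_subset_shift_closure:
  assumes "m \<ge> 2"
  shows "X m \<subseteq> shift_closure m (inverses (Sos m))"
proof
  fix \<theta> assume X: "\<theta> \<in> X m"
  then obtain k \<theta>' where n: "normal_quasi_progression m k \<theta>'" and s: "shift_equivalent m \<theta>' \<theta>"
    using X_shift_normal[OF assms] by blast
  have "\<theta>' \<in> inverses (Sos m)"
    using normal_quasi_progression.inv_mem_Sos[OF n] normal_quasi_progression.perm[OF n]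
    by (simp add: mem_inverses_iff[OF Sos_subset_Sym])
  then show "\<theta> \<in> shift_closure m (inverses (Sos m))"
    using X s unfolding shift_closure_def X_def by blast
qed

theorem corollary2:
  fixes m :: nat
  assumes "m \<ge> 2"
  shows "X m = shift_closure m (inverses (Sos m))
    \<and> shift_closure m (inverses (Sos m)) = inverses (Sos_type m)"
proof -
  \<comment> \<open>Three inclusions in a cycle give both equalities.\<close>
  have "shift_closure m (inverses (Sos m)) \<subseteq> inverses (Sos_type m)"
    using shift_closure_inverses_Sos_subset assms by simp
  then show ?thesis
    using X_subset_shift_closure[OF assms] inverses_Sos_type_subset_X[OF assms] by blast
qed

end
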